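(* Let $X$ and $Y$ be Banach spaces with dual spaces $X^*$ and $Y^*$, and let $C\subseteq X$ and $D\subseteq Y$ be nonempty, closed and convex subsets. Let $f:C\to X^*$ and $g:D\to Y^*$ be continuous operators and let $A:X\to Y$ be a bounded linear operator satisfying: (a1) $AC=D$; (a2) $A$ is convexity direction reserved with respect to $f$ and $g$ on $C$ and $D$. Suppose there is $(x_0,Ax_0)\in C\times D$ such that the set $$\{(x',Ax')\in C\times D:\ \langle f(x'),x_0-x'\rangle\ge 0\ \text{ and }\ \langle g(Ax'),Ax_0-Ax'\rangle\ge 0\}$$ is compact. Then the split variational inequality problem $\mathrm{SVIP}(f,C,A,g,D)$ has a solution; that is, there is $x_*\in C$ with $Ax_*\in D$ such that $\langle f(x_* ),x-x_*\rangle\ge 0$ for all $x\in C$ and $\langle g(Ax_* ),y-Ax_*\rangle\ge 0$ for all $y\in D$.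
   Context: $\langle\cdot,\cdot\rangle$ denotes the pairing between $X^*$ and $X$ and also between $Y^*$ and $Y$. $AC=\{Ax: x\in C\}$. $X\times Y$ carries the product topology. A strictly linear combination of vectors $x_1,\dots,x_n$ is a vector $\sum_{i=1}^n\lambda_i x_i$ with $0<\lambda_1,\dots,\lambda_n<1$ and $\sum_{i=1}^n\lambda_i=1$. The bounded linear operator $A:X\to Y$ is convexity direction reserved (has the convexity direction reserving property) with respect to $f$ and $g$ on $C$ and $D$ if, for any vectors $x_1,\dots,x_n$ in $C$ and any strictly linear combination $x'=\sum_{i=1}^n\lambda_i x_i$, there is a positive integer $j\le n$ such that both $\langle f(x'),x_j-x'\rangle\ge 0$ and $\langle g(Ax'),Ax_j-Ax'\rangle\ge 0$ hold. *)

theory Defs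
  imports "HOL-Analysis.Analysis"
begin

text \<open>
  The dual of a real normed space is its space of bounded linear functionals, with the operator
  norm; the pairing is application. Operators given only on \<open>C\<close> (or \<open>D\<close>) are total functions whose
  values outside that set are never used.
\<close>

type_synonym 'a dual = "'a \<Rightarrow>\<^sub>L real"

abbreviation pairing :: "'a::real_normed_vector dual \<Rightarrow> 'a \<Rightarrow> real" ("\<langle>_, _\<rangle>")
  where "\<langle>\<phi>, x\<rangle> \<equiv> blinfun_apply \<phi> x"

text \<open>The strict upper bound on the coefficients excludes \<open>n = 1\<close>.\<close>

definition strictly_linear_combination ::
    "nat \<Rightarrow> (nat \<Rightarrow> 'a::real_vector) \<Rightarrow> 'a \<Rightarrow> bool"
  where "strictly_linear_combination n x x' \<longleftrightarrow>
    (\<exists>l :: nat \<Rightarrow> real. (\<forall>i\<in>{1..n}. 0 < l i \<and> l i < 1) \<and> (\<Sum>i=1..n. l i) = 1 \<and>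
      x' = (\<Sum>i=1..n. l i *\<^sub>R x i))"

text \<open>
  The set \<open>D\<close> enters only as the domain of \<open>g\<close>: the points \<open>A x'\<close> lie in \<open>D\<close> when \<open>C\<close> is convex
  and \<open>A ` C \<subseteq> D\<close>. So it is not a parameter here.
\<close>

definition convexity_direction_reserved ::
    "('a::real_normed_vector \<Rightarrow> 'b::real_normed_vector) \<Rightarrow> ('a \<Rightarrow> 'a dual) \<Rightarrow> ('b \<Rightarrow> 'b dual)
      \<Rightarrow> 'a set \<Rightarrow> bool"
  where "convexity_direction_reserved A f g C \<longleftrightarrow>
    (\<forall>n x x'. (\<forall>i\<in>{1..n}. x i \<in> C) \<longrightarrow> strictly_linear_combination n x x' \<longrightarrow>
      (\<exists>j\<in>{1..n}. \<langle>f x', x j - x'\<rangle> \<ge> 0 \<and> \<langle>g (A x'), A (x j) - A x'\<rangle> \<ge> 0))"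

definition SVIP_solution ::
    "('a::real_normed_vector \<Rightarrow> 'a dual) \<Rightarrow> 'a set \<Rightarrow> ('a \<Rightarrow> 'b::real_normed_vector)
      \<Rightarrow> ('b \<Rightarrow> 'b dual) \<Rightarrow> 'b set \<Rightarrow> 'a \<Rightarrow> bool"
  where "SVIP_solution f C A g D z \<longleftrightarrow>
    z \<in> C \<and> A z \<in> D \<and> (\<forall>x\<in>C. \<langle>f z, x - z\<rangle> \<ge> 0) \<and> (\<forall>y\<in>D. \<langle>g (A z), y - A z\<rangle> \<ge> 0)"

end

theory Submission
  imports Defs
begin

text \<open>
  A solution is exactly a point of \<open>\<Inter>x\<in>C. F x\<close>, where \<open>F x\<close> is the set of all \<open>z \<in> C\<close> with
  \<open>\<langle>f z, x - z\<rangle> \<ge> 0\<close> and \<open>\<langle>g (A z), A x - A z\<rangle> \<ge> 0\<close>. Each \<open>F x\<close> is closed by continuity, \<open>F x0\<close>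
  is compact, and convexity direction reservation says precisely that \<open>F\<close> is a KKM map. The
  Fan-KKM theorem therefore gives a common point. As the number of vertices in the KKM theorem
  is not bounded, Brouwer's theorem is needed in a form whose dimension is a number and not a
  type; it follows from Kuhn's combinatorial lemma by compactness.
\<close>

section \<open>Brouwer's fixed point theorem on the cube, with numerical dimension\<close>

text \<open>Points carry a coordinate for every natural number, so this is the Hilbert cube. The
  dimension \<open>n\<close> later only says which coordinates matter, and Tychonoff's theorem gives
  compactness once and for all.\<close>

definition unit_cube :: "(nat \<Rightarrow> real) set"
  where "unit_cube = {t. \<forall>i. 0 \<le> t i \<and> t i \<le> 1}"

lemma compact_unit_cube: "compact unit_cube"
proof -
  have "compactin (product_topology (\<lambda>i::nat. euclidean :: real topology) UNIV)
          (\<Pi>\<^sub>E i\<in>UNIV. {0..1})"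
    by (simp add: compactin_PiE)
  moreover have "(\<Pi>\<^sub>E i\<in>UNIV. {0..1}) = unit_cube"
    by (auto simp: unit_cube_def PiE_def Pi_def)
  ultimately show ?thesis
    by (simp add: euclidean_product_topology)
qed

lemma tendsto_fun_iff:
  fixes f :: "'a \<Rightarrow> 'i \<Rightarrow> 'b::topological_space"
  shows "(f \<longlongrightarrow> l) F \<longleftrightarrow> (\<forall>i. ((\<lambda>x. f x i) \<longlongrightarrow> l i) F)"
  using limitin_componentwise[of "\<lambda>i::'i. euclidean :: 'b topology" UNIV f l F]
  by (simp add: euclidean_product_topology)

text \<open>Kuhn's lemma on the grid of mesh \<open>1 / p\<close> finds a cell on which every label
  takes both values. The witnesses \<open>v\<close> and \<open>w\<close> vary with the coordinate
  \<open>i\<close>, but all lie within one mesh of the same corner \<open>u\<close>. Continuity of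
  \<open>h\<close> enters only when the mesh is refined.\<close>

lemma kuhn_approximation:
  fixes h :: "(nat \<Rightarrow> real) \<Rightarrow> nat \<Rightarrow> real"
  assumes p: "0 < p"
    and h: "\<And>t i. t \<in> unit_cube \<Longrightarrow> i < n \<Longrightarrow> 0 \<le> h t i \<and> h t i \<le> 1"
  obtains u where "u \<in> unit_cube"
    and "\<And>i. i < n \<Longrightarrow> \<exists>v\<in>unit_cube. \<exists>w\<in>unit_cube.
      (\<forall>j. \<bar>v j - u j\<bar> \<le> 1 / real p \<and> \<bar>w j - u j\<bar> \<le> 1 / real p) \<and> v i \<le> h v i \<and> h w i \<le> w i"
proof -
  \<comment> \<open>The value 0 from index \<open>n\<close> on makes grid points agree there, so the
    distance bound holds in every coordinate.\<close>
  define grid where "grid x = (\<lambda>i. if i < n then real (x i) / real p else 0)" for x :: "nat \<Rightarrow> nat"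
  \<comment> \<open>Label 0 records that \<open>h\<close> does not decrease coordinate
    \<open>i\<close>. The test \<open>x i < p\<close> forces label 1 on the upper face, where the
    coordinate is 1 and \<open>h\<close> cannot exceed it.\<close>
  define label where
    "label x i = (if x i < p \<and> grid x i \<le> h (grid x) i then 0 else 1 :: nat)" for x i
  have grid: "grid x \<in> unit_cube" if "\<forall>i<n. x i \<le> p" for x
    using that p by (auto simp: grid_def unit_cube_def)
  have lab0: "\<forall>x. (\<forall>i<n. x i \<le> p) \<longrightarrow> (\<forall>i<n. x i = 0 \<longrightarrow> label x i = 0)"
    using p h grid by (auto simp: label_def grid_def)
  have lab1: "\<forall>x. (\<forall>i<n. x i \<le> p) \<longrightarrow> (\<forall>i<n. x i = p \<longrightarrow> label x i = 1)"
    by (simp add: label_def)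
  have "\<forall>x. (\<forall>i<n. x i \<le> p) \<longrightarrow> (\<forall>i<n. label x i = 0 \<or> label x i = 1)"
    by (simp add: label_def)
  from kuhn_lemma[OF p this lab0 lab1] obtain q where q: "\<forall>i<n. q i < p"
    and rs: "\<forall>i<n. \<exists>r s. (\<forall>j<n. q j \<le> r j \<and> r j \<le> q j + 1) \<and>
      (\<forall>j<n. q j \<le> s j \<and> s j \<le> q j + 1) \<and> label r i \<noteq> label s i"
    by blast
  have cell: "grid x \<in> unit_cube \<and> (\<forall>j. \<bar>grid x j - grid q j\<bar> \<le> 1 / real p)"
    if "\<forall>j<n. q j \<le> x j \<and> x j \<le> q j + 1" for x
  proof
    show "grid x \<in> unit_cube"
      using that q by (intro grid) force
    show "\<forall>j. \<bar>grid x j - grid q j\<bar> \<le> 1 / real p"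
    proof
      fix j
      show "\<bar>grid x j - grid q j\<bar> \<le> 1 / real p"
      proof (cases "j < n")
        case True
        then have "\<bar>real (x j) - real (q j)\<bar> \<le> 1"
          using that by force
        then show ?thesis
          using True p by (simp add: grid_def divide_right_mono flip: diff_divide_distrib)
      qed (simp add: grid_def)
    qed
  qed
  have low: "grid x i \<le> h (grid x) i" if "label x i = 0" for x i
    using that by (auto simp: label_def split: if_splits)
  have high: "h (grid x) i \<le> grid x i" if "label x i = 1" "i < n" "grid x \<in> unit_cube" for x i
  proof (cases "x i < p")
    case True
    then show ?thesis
      using that by (auto simp: label_def split: if_splits)
  next
    case False
    then have "1 \<le> grid x i"
      using p \<open>i < n\<close> by (simp add: grid_def)
    then show ?thesis
      using h[OF that(3,2)] by linarith
  qed
  have label01: "label x i = 0 \<or> label x i = 1" for x i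
    by (simp add: label_def)
  show thesis
  proof
    show "grid q \<in> unit_cube"
      using q by (intro grid) force
    fix i assume i: "i < n"
    then obtain r s where r: "\<forall>j<n. q j \<le> r j \<and> r j \<le> q j + 1"
      and s: "\<forall>j<n. q j \<le> s j \<and> s j \<le> q j + 1" and ne: "label r i \<noteq> label s i"
      using rs by blast
    show "\<exists>v\<in>unit_cube. \<exists>w\<in>unit_cube. (\<forall>j. \<bar>v j - grid q j\<bar> \<le> 1 / real p \<and>
      \<bar>w j - grid q j\<bar> \<le> 1 / real p) \<and> v i \<le> h v i \<and> h w i \<le> w i"
    proof (cases "label r i = 0")
      case True
      then have "label s i = 1"
        using ne label01[of s i] by simp
      with True show ?thesis
        using cell[OF r] cell[OF s] low high i by blast
    next
      case False
      then have "label r i = 1" "label s i = 0"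
        using ne label01[of r i] label01[of s i] by simp_all
      then show ?thesis
        using cell[OF r] cell[OF s] low high i by blast
    qed
  qed
qed

text \<open>As the mesh tends to 0, a subsequence of the points \<open>u\<close> converges, and for
  each \<open>i\<close> the witnesses \<open>v\<close> and \<open>w\<close> follow it to the same
  limit. By continuity both inequalities survive there, giving equality in coordinate
  \<open>i\<close>.\<close>

lemma brouwer_unit_cube:
  fixes h :: "(nat \<Rightarrow> real) \<Rightarrow> nat \<Rightarrow> real"
  assumes cont: "\<And>i. i < n \<Longrightarrow> continuous_on unit_cube (\<lambda>t. h t i)"
    and h: "\<And>t i. t \<in> unit_cube \<Longrightarrow> i < n \<Longrightarrow> 0 \<le> h t i \<and> h t i \<le> 1"
  obtains t where "t \<in> unit_cube" and "\<And>i. i < n \<Longrightarrow> h t i = t i"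
proof -
  have "\<exists>u\<in>unit_cube. \<forall>i<n. \<exists>v\<in>unit_cube. \<exists>w\<in>unit_cube.
      (\<forall>j. \<bar>v j - u j\<bar> \<le> 1 / real (Suc N) \<and> \<bar>w j - u j\<bar> \<le> 1 / real (Suc N)) \<and>
      v i \<le> h v i \<and> h w i \<le> w i" for N
    using kuhn_approximation[of "Suc N" n h] h by (metis zero_less_Suc)
  then obtain U where U: "\<And>N. U N \<in> unit_cube"
    and VW: "\<And>N i. i < n \<Longrightarrow> \<exists>v\<in>unit_cube. \<exists>w\<in>unit_cube.
      (\<forall>j. \<bar>v j - U N j\<bar> \<le> 1 / real (Suc N) \<and> \<bar>w j - U N j\<bar> \<le> 1 / real (Suc N)) \<and>
      v i \<le> h v i \<and> h w i \<le> w i"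
    by metis
  \<comment> \<open>The index type \<open>nat\<close> is countable, so the product topology is
    metrizable and compactness yields convergent subsequences.\<close>
  have "seq_compact unit_cube"
    using compact_unit_cube by (simp add: compact_eq_seq_compact_metric)
  then obtain l \<rho> where l: "l \<in> unit_cube" and \<rho>: "strict_mono \<rho>" and lim: "(U \<circ> \<rho>) \<longlonglongrightarrow> l"
    using seq_compactE U by metis
  have near: "(\<lambda>N. V (\<rho> N)) \<longlonglongrightarrow> l"
    if V: "\<And>N j. \<bar>V N j - U N j\<bar> \<le> 1 / real (Suc N)" for V
    unfolding tendsto_fun_iff
  proof
    fix j
    have "(\<lambda>N. 1 / real (Suc N)) \<longlonglongrightarrow> 0"
      using LIMSEQ_inverse_real_of_nat by (simp add: inverse_eq_divide)
    then have "(\<lambda>N. V N j - U N j) \<longlonglongrightarrow> 0"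
      by (rule Lim_null_comparison[rotated]) (use V in auto)
    then have "(\<lambda>N. V (\<rho> N) j - U (\<rho> N) j) \<longlonglongrightarrow> 0"
      using LIMSEQ_subseq_LIMSEQ[OF _ \<rho>] by (fastforce simp: o_def)
    moreover have "(\<lambda>N. U (\<rho> N) j) \<longlonglongrightarrow> l j"
      using lim by (simp add: tendsto_fun_iff)
    ultimately show "(\<lambda>N. V (\<rho> N) j) \<longlonglongrightarrow> l j"
      using tendsto_add by fastforce
  qed
  have hlim: "(\<lambda>N. h (V (\<rho> N)) i) \<longlonglongrightarrow> h l i"
    if "i < n" "(\<lambda>N. V (\<rho> N)) \<longlonglongrightarrow> l" "\<And>N. V N \<in> unit_cube" for V i
    using continuous_on_tendsto_compose[OF cont[OF that(1)] that(2) l] that(3) by simp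
  show thesis
  proof
    fix i assume i: "i < n"
    obtain V W where V: "\<And>N. V N \<in> unit_cube" and W: "\<And>N. W N \<in> unit_cube"
      and VU: "\<And>N j. \<bar>V N j - U N j\<bar> \<le> 1 / real (Suc N)"
      and WU: "\<And>N j. \<bar>W N j - U N j\<bar> \<le> 1 / real (Suc N)"
      and Vh: "\<And>N. V N i \<le> h (V N) i" and Wh: "\<And>N. h (W N) i \<le> W N i"
      using VW[OF i] by metis
    have "l i \<le> h l i"
      using near[OF VU] hlim[OF i near[OF VU] V] Vh
      by (intro LIMSEQ_le[of "\<lambda>N. V (\<rho> N) i" "l i" "\<lambda>N. h (V (\<rho> N)) i"])
        (auto simp: tendsto_fun_iff)
    moreover have "h l i \<le> l i"
      using near[OF WU] hlim[OF i near[OF WU] W] Wh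
      by (intro LIMSEQ_le[of "\<lambda>N. h (W (\<rho> N)) i" "h l i" "\<lambda>N. W (\<rho> N) i"])
        (auto simp: tendsto_fun_iff)
    ultimately show "h l i = l i"
      by simp
  qed (rule l)
qed

section \<open>The KKM theorem and Fan's extension to infinite families\<close>

text \<open>If there were no common point, the distances to the sets \<open>F (x i)\<close>,
  normalised to sum 1, would define new weights from old ones. A fixed point puts positive weight
  exactly on the vertices whose sets miss it, against the covering of their hull.\<close>

theorem knaster_kuratowski_mazurkiewicz:
  fixes F :: "'a::real_normed_vector \<Rightarrow> 'a set"
  assumes fin: "finite S"
    and closed: "\<And>x. x \<in> S \<Longrightarrow> closed (F x)"
    and kkm: "\<And>T. T \<subseteq> S \<Longrightarrow> convex hull T \<subseteq> (\<Union>x\<in>T. F x)"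
  shows "(\<Inter>x\<in>S. F x) \<noteq> {}"
proof
  assume empty: "(\<Inter>x\<in>S. F x) = {}"
  obtain x where x: "bij_betw x {..<card S} S"
    using ex_bij_betw_nat_finite[OF fin] by (auto simp: atLeast0LessThan)
  define n where "n = card S"
  have xS: "x i \<in> S" if "i < n" for i
    using x that by (auto simp: bij_betw_def n_def)
  have Sx: "S = x ` {..<n}"
    using x by (simp add: bij_betw_def n_def)
  define d where "d i y = infdist y (F (x i))" for i y
  define P where "P t = (\<Sum>i<n. t i *\<^sub>R x i)" for t :: "nat \<Rightarrow> real"
  have nonneg: "0 \<le> d i y" for i y
    by (simp add: d_def infdist_nonneg)
  have nonempty: "F z \<noteq> {}" if "z \<in> S" for z
    using kkm[of "{z}"] that by auto
  have dpos: "0 < d i y \<longleftrightarrow> y \<notin> F (x i)" if "i < n" for i y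
    using infdist_pos_not_in_closed[OF closed nonempty] xS[OF that] by (auto simp: d_def)
  \<comment> \<open>Since the intersection is empty in the whole space, the weights can be normalised at every
    point of the cube, and not only at the points of the simplex.\<close>
  have sumpos: "0 < (\<Sum>i<n. d i y)" for y
  proof -
    obtain i where "i < n" "y \<notin> F (x i)"
      using empty Sx by blast
    then show ?thesis
      using dpos nonneg by (intro sum_pos2[of _ i]) auto
  qed
  define h where "h t i = d i (P t) / (\<Sum>j<n. d j (P t))" for t i
  have contP: "continuous_on unit_cube P"
    unfolding P_def
    by (intro continuous_intros continuous_on_subset[OF continuous_on_product_coordinates]) auto
  have conth: "continuous_on unit_cube (\<lambda>t. h t i)" for i
    using sumpos contP unfolding h_def d_def
    by (intro continuous_intros) (auto simp: less_imp_neq[symmetric])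
  have h01: "0 \<le> h t i \<and> h t i \<le> 1" if "i < n" for t i
    using sumpos nonneg member_le_sum[of i "{..<n}" "\<lambda>i. d i (P t)"] that
    by (auto simp: h_def divide_le_eq intro!: divide_nonneg_pos)
  then obtain t where t: "\<And>i. i < n \<Longrightarrow> h t i = t i"
    using brouwer_unit_cube[of n h] conth h01 by metis
  \<comment> \<open>These are the indices whose sets miss \<open>P t\<close>. At the fixed point
    \<open>t i\<close> is proportional to \<open>d i (P t)\<close>, so they are also the support of
    \<open>t\<close>.\<close>
  define J where "J = {i. i < n \<and> 0 < d i (P t)}"
  have t0: "0 \<le> t i" if "i < n" for i
    using h01[OF that] t[OF that] by metis
  have "(\<Sum>i<n. t i) = (\<Sum>i<n. h t i)"
    using t by simp
  also have "\<dots> = 1"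
    using sumpos[of "P t"] by (simp add: h_def flip: sum_divide_distrib)
  finally have sum1: "(\<Sum>i<n. t i) = 1" .
  have zero: "t i = 0" if "i \<in> {..<n} - J" for i
    using that nonneg[of i "P t"] t[of i] by (auto simp: J_def h_def)
  have JS: "J \<subseteq> {..<n}"
    by (auto simp: J_def)
  have "(\<Sum>i\<in>J. t i) = 1"
    using sum1 sum.mono_neutral_right[of "{..<n}" J t] JS zero by simp
  then have "(\<Sum>i\<in>J. t i *\<^sub>R x i) \<in> convex hull (x ` J)"
    using JS t0 finite_subset[OF JS]
    by (intro convex_sum) (auto intro: hull_inc)
  moreover have "(\<Sum>i\<in>J. t i *\<^sub>R x i) = P t"
    unfolding P_def using JS zero by (intro sum.mono_neutral_left) auto
  moreover have "x ` J \<subseteq> S"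
    using JS xS by auto
  ultimately obtain i where "i \<in> J" "P t \<in> F (x i)"
    using kkm[of "x ` J"] by auto
  then show False
    using dpos by (auto simp: J_def)
qed

text \<open>The finite intersection property inside the compact set \<open>F x0\<close> reduces the
  claim to finite subfamilies.\<close>

theorem fan_kkm:
  fixes F :: "'a::real_normed_vector \<Rightarrow> 'a set"
  assumes closed: "\<And>x. x \<in> C \<Longrightarrow> closed (F x)"
    and x0: "x0 \<in> C" "compact (F x0)"
    and kkm: "\<And>T. finite T \<Longrightarrow> T \<subseteq> C \<Longrightarrow> convex hull T \<subseteq> (\<Union>x\<in>T. F x)"
  shows "(\<Inter>x\<in>C. F x) \<noteq> {}"
proof -
  have "F x0 \<inter> (\<Inter>x\<in>C. F x) \<noteq> {}"
  proof (rule compact_imp_fip_image[OF x0(2) closed])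
    fix S assume S: "finite S" "S \<subseteq> C"
    \<comment> \<open>Adding \<open>x0\<close> as a vertex places the common point inside
      \<open>F x0\<close>.\<close>
    have "(\<Inter>x\<in>insert x0 S. F x) \<noteq> {}"
    proof (rule knaster_kuratowski_mazurkiewicz)
      fix T assume "T \<subseteq> insert x0 S"
      then show "convex hull T \<subseteq> (\<Union>x\<in>T. F x)"
        using S x0 by (intro kkm) (auto intro: finite_subset)
    qed (use S x0 closed in auto)
    then show "F x0 \<inter> (\<Inter>x\<in>S. F x) \<noteq> {}"
      by simp
  qed
  then show ?thesis
    by blast
qed

section \<open>Application to the split variational inequality\<close>

text \<open>Zero weights are dropped from a convex combination. If a remaining weight reached 1, no
  other could be positive and \<open>z\<close> would be a vertex; that case stands apart because
  strict combinations exclude a single coefficient 1.\<close>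

lemma convex_hull_cases_strict:
  assumes "finite T" and "z \<in> convex hull T"
  obtains "z \<in> T"
  | n x where "\<And>i. i \<in> {1..n} \<Longrightarrow> x i \<in> T" and "strictly_linear_combination n x z"
proof (cases "z \<in> T")
  case False
  obtain u where u: "\<forall>x\<in>T. 0 \<le> u x" and sum1: "sum u T = 1" and z: "(\<Sum>x\<in>T. u x *\<^sub>R x) = z"
    using assms by (auto simp: convex_hull_finite)
  define J where "J = {x \<in> T. 0 < u x}"
  have J: "finite J" "J \<subseteq> T"
    using assms(1) by (auto simp: J_def)
  have zero: "\<forall>x\<in>T - J. u x = 0"
    using u by (force simp: J_def)
  have sumJ: "sum u J = 1"
    using sum.mono_neutral_right[of T J u] assms(1) J zero sum1 by simp
  have zJ: "(\<Sum>x\<in>J. u x *\<^sub>R x) = z"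
    using sum.mono_neutral_right[of T J "\<lambda>x. u x *\<^sub>R x"] assms(1) J zero z by simp
  have less1: "u y < 1" if y: "y \<in> J" for y
  proof (rule ccontr)
    assume "\<not> u y < 1"
    moreover have "sum u J = u y + sum u (J - {y})"
      using J y by (simp add: sum.remove)
    ultimately have le0: "sum u (J - {y}) \<le> 0"
      using sumJ by simp
    have "J - {y} = {}"
    proof (rule ccontr)
      assume "J - {y} \<noteq> {}"
      then have "0 < sum u (J - {y})"
        using J by (intro sum_pos) (auto simp: J_def)
      with le0 show False by simp
    qed
    then have "J = {y}"
      using y by blast
    then have "z = y"
      using zJ sumJ by simp
    then show False
      using False y J by blast
  qed
  obtain x where x: "bij_betw x {1..card J} J"
    using ex_bij_betw_nat_finite_1[OF J(1)] by blast
  then have xJ: "x i \<in> J" if "i \<in> {1..card J}" for i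
    using that by (auto simp: bij_betw_def)
  have "strictly_linear_combination (card J) x z"
    unfolding strictly_linear_combination_def
  proof (intro exI[of _ "u \<circ> x"] conjI ballI)
    show "(\<Sum>i=1..card J. (u \<circ> x) i) = 1"
      using sum.reindex_bij_betw[OF x, of u] sumJ by simp
    show "z = (\<Sum>i=1..card J. (u \<circ> x) i *\<^sub>R x i)"
      using sum.reindex_bij_betw[OF x, of "\<lambda>y. u y *\<^sub>R y"] zJ by simp
  qed (use xJ less1 in \<open>auto simp: J_def\<close>)
  then show thesis
    using that(2) xJ J by blast
qed (use that in blast)

theorem theorem2p3:
  fixes C :: "'a::banach set" and D :: "'b::banach set"
    and f :: "'a \<Rightarrow> 'a dual" and g :: "'b \<Rightarrow> 'b dual"
    and A :: "'a \<Rightarrow> 'b"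
  assumes "C \<noteq> {}" and "closed C" and "convex C"
    and "D \<noteq> {}" and "closed D" and "convex D"
    and "continuous_on C f" and "continuous_on D g"
    and "bounded_linear A"
    and "A ` C = D"
    and "convexity_direction_reserved A f g C"
    and "\<exists>x0. (x0, A x0) \<in> C \<times> D \<and>
      compact {(x', A x') | x'. (x', A x') \<in> C \<times> D \<and>
        \<langle>f x', x0 - x'\<rangle> \<ge> 0 \<and> \<langle>g (A x'), A x0 - A x'\<rangle> \<ge> 0}"
  shows "\<exists>z. SVIP_solution f C A g D z"
proof -
  define F where
    "F x = {z \<in> C. 0 \<le> \<langle>f z, x - z\<rangle> \<and> 0 \<le> \<langle>g (A z), A x - A z\<rangle>}" for x
  obtain x0 where x0: "x0 \<in> C"
    and comp: "compact {(x', A x') | x'. (x', A x') \<in> C \<times> D \<and>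
        \<langle>f x', x0 - x'\<rangle> \<ge> 0 \<and> \<langle>g (A x'), A x0 - A x'\<rangle> \<ge> 0}"
    using assms(12) by blast
  \<comment> \<open>The compactness hypothesis concerns a piece of the graph of \<open>A\<close>;
    its first projection is \<open>F x0\<close>, since \<open>A\<close> maps \<open>C\<close> into
    \<open>D\<close>.\<close>
  have "fst ` {(x', A x') | x'. (x', A x') \<in> C \<times> D \<and>
        \<langle>f x', x0 - x'\<rangle> \<ge> 0 \<and> \<langle>g (A x'), A x0 - A x'\<rangle> \<ge> 0} = F x0"
    using assms(10) by (force simp: F_def image_iff)
  then have "compact (F x0)"
    using compact_continuous_image[OF continuous_on_fst[OF continuous_on_id] comp] by simp
  moreover have "closed (F x)" for x
  proof -
    have contA: "continuous_on C A"
      by (rule linear_continuous_on[OF assms(9)])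
    have "continuous_on C (\<lambda>z. \<langle>f z, x - z\<rangle>)"
      using assms(7) by (intro continuous_intros)
    moreover have "continuous_on C (\<lambda>z. g (A z))"
      using continuous_on_compose2[OF assms(8) contA] assms(10) by blast
    then have "continuous_on C (\<lambda>z. \<langle>g (A z), A x - A z\<rangle>)"
      using contA by (intro continuous_intros)
    ultimately have "closed {z \<in> C. 0 \<le> \<langle>f z, x - z\<rangle>}"
      and "closed {z \<in> C. 0 \<le> \<langle>g (A z), A x - A z\<rangle>}"
      using assms(2) by (auto intro!: continuous_on_closed_Collect_le continuous_intros)
    then have "closed ({z \<in> C. 0 \<le> \<langle>f z, x - z\<rangle>} \<inter> {z \<in> C. 0 \<le> \<langle>g (A z), A x - A z\<rangle>})"
      by (rule closed_Int)
    then show ?thesis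
      by (rule back_subst[of closed]) (auto simp: F_def)
  qed
  moreover have "convex hull T \<subseteq> (\<Union>x\<in>T. F x)" if T: "finite T" "T \<subseteq> C" for T
  proof
    fix z assume z: "z \<in> convex hull T"
    then have zC: "z \<in> C"
      using T assms(3) hull_minimal by blast
    from T(1) z show "z \<in> (\<Union>x\<in>T. F x)"
    proof (cases rule: convex_hull_cases_strict)
      \<comment> \<open>A vertex lies in its own set, as both pairings are taken at the zero
        vector.\<close>
      case 1
      moreover have "z \<in> F z"
        using zC by (simp add: F_def)
      ultimately show ?thesis
        by blast
    next
      case (2 n x)
      then obtain j where "j \<in> {1..n}" "0 \<le> \<langle>f z, x j - z\<rangle>" "0 \<le> \<langle>g (A z), A (x j) - A z\<rangle>"
        using assms(11) T(2) unfolding convexity_direction_reserved_def by blast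
      then show ?thesis
        using 2(1) zC by (auto simp: F_def)
    qed
  qed
  ultimately obtain z where "z \<in> (\<Inter>x\<in>C. F x)"
    using fan_kkm[of C F x0] x0 by blast
  then have z: "z \<in> F x" if "x \<in> C" for x
    using that by blast
  \<comment> \<open>Every \<open>y\<close> in \<open>D\<close> has the form \<open>A x\<close> with
    \<open>x\<close> in \<open>C\<close>, so the inequalities indexed by \<open>C\<close> cover
    \<open>D\<close>. Membership of \<open>z\<close> in \<open>C\<close> is read off from
    \<open>F x0\<close>.\<close>
  then have "SVIP_solution f C A g D z"
    using z[OF x0] assms(10) unfolding SVIP_solution_def F_def by blast
  then show ?thesis ..
qed

end
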